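(* Let $G$ be a $2$-connected $2$-leaf-stable graph with fault cost $1$, let $a_1,a_2\in V(G)$ be vertices such that $G$ has a hamiltonian $a_1a_2$-path and $G-z$ has a hamiltonian $a_1a_2$-path for every $z\in V(G)\setminus\{a_1,a_2\}$, let $\{x,y\}$ be a $2$-separator of $G$ with $xy\in E(G)$, and let $G_1,G_2$ be the two $2$-fragments of $G$ with attachment $\{x,y\}$, where $a_i\in V(G_i)$ for $i=1,2$. Then $(G_1,a_1,x,y)$ and $(G_2,a_2,x,y)$ are weak fragments, and either both of them are medium fragments or one of them is a strong fragment.
   Context: Graphs are finite, simple and undirected. A graph is hamiltonian if it has a cycle through all its vertices ($K_1,K_2$ are not); a hamiltonian $ab$-path is a path through all vertices with end-vertices $a,b$. The minimum leaf number ${\rm ml}(G)$ is $1$ if $G$ is hamiltonian, $\infty$ if disconnected, otherwise the minimum number of leaves of a spanning tree. $G$ is $2$-leaf-stable if ${\rm ml}(G)=2$ and ${\rm ml}(G-v)=2$ for all $v$. An ml-subgraph is a hamiltonian cycle if $G$ is hamiltonian, otherwise a spanning tree with ${\rm ml}(G)$ leaves; ${\cal S}_{\rm ml}(G)$ is the set of these. For $S\in{\cal S}_{\rm ml}(G)$, $v\in V(G)$, $S_v\in{\cal S}_{\rm ml}(G-v)$, $\tau(S,S_v)=|\{u\in V(G)\setminus\{v\}:\deg_S(u)\ne\deg_{S_v}(u)\}|$, $\varphi_S(G)=\max_v\min_{S_v}\tau(S,S_v)$, fault cost $\varphi(G)=\min_S\varphi_S(G)$. A $2$-separator is a set $X$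 of two vertices with $G-X$ disconnected; for a component $H$ of $G-X$, $G[V(H)\cup X]$ is a $2$-fragment with attachment $X$ (for $G$, $a_1,a_2$, $\{x,y\}$ as in the claim, there are exactly two such fragments, one containing $a_1$, the other $a_2$). For a connected graph $H$ and $a,x,y\in V(H)$ with $xy\in E(H)$: ($P_0$) $H$ has a hamiltonian $ax$- or $ay$-path, and for every $v\in V(H)\setminus\{a\}$ so does $H-v$; ($Q_1$) $H$ has no hamiltonian $xy$-path; ($Q_2$) for every $v\in V(H)\setminus\{a\}$, $H-v$ has no hamiltonian $xy$-path. $(H,a,x,y)$ is a weak fragment if ($P_0$) holds, medium if ($P_0$),($Q_1$) hold, strong if ($P_0$),($Q_1$),($Q_2$) hold. *)

theory Defs
  imports
    "Graph_Theory.Digraph_Component_Vwalk"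
    "HOL-Library.Extended_Nat"
begin

text \<open>
  A finite simple undirected graph is an instance of the locale \<open>graph\<close>: a finite symmetric
  digraph without loops and parallel arcs, in which each undirected edge is a pair of opposite
  arcs.  Components are therefore strongly connected components, and the degree of a vertex is
  its out-degree.  The library notions of cycle and tree are not usable here, since a pair of
  opposite arcs counts as a cycle there.
\<close>

abbreviation deg :: "('a,'b) pre_digraph \<Rightarrow> 'a \<Rightarrow> nat" where
  "deg G v \<equiv> out_degree G v"

abbreviation minus_vertex :: "('a,'b) pre_digraph \<Rightarrow> 'a \<Rightarrow> ('a,'b) pre_digraph" where
  "minus_vertex G v \<equiv> pre_digraph.del_vert G v"

definition undirected_cycle :: "('a,'b) pre_digraph \<Rightarrow> bool" where
  "undirected_cycle C \<longleftrightarrow> graph C \<and>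
     (\<exists>p. distinct p \<and> 3 \<le> length p \<and> verts C = set p \<and>
        arcs_ends C = set (vwalk_arcs (p @ [hd p])) \<union> (set (vwalk_arcs (p @ [hd p])))\<inverse>)"

definition hamiltonian_cycle :: "('a,'b) pre_digraph \<Rightarrow> ('a,'b) pre_digraph \<Rightarrow> bool" where
  "hamiltonian_cycle C G \<longleftrightarrow> undirected_cycle C \<and> spanning C G"

definition hamiltonian :: "('a,'b) pre_digraph \<Rightarrow> bool" where
  "hamiltonian G \<longleftrightarrow> (\<exists>C. hamiltonian_cycle C G)"

definition hamiltonian_path :: "('a,'b) pre_digraph \<Rightarrow> 'a \<Rightarrow> 'a \<Rightarrow> bool" where
  "hamiltonian_path G a b \<longleftrightarrow> (\<exists>p. vpath p G \<and> set p = verts G \<and> hd p = a \<and> last p = b)"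

definition undirected_tree :: "('a,'b) pre_digraph \<Rightarrow> bool" where
  "undirected_tree T \<longleftrightarrow>
     graph T \<and> connected T \<and> (\<nexists>C. undirected_cycle C \<and> subgraph C T)"

definition undirected_spanning_tree :: "('a,'b) pre_digraph \<Rightarrow> ('a,'b) pre_digraph \<Rightarrow> bool" where
  "undirected_spanning_tree T G \<longleftrightarrow> undirected_tree T \<and> spanning T G"

definition num_leaves :: "('a,'b) pre_digraph \<Rightarrow> nat" where
  "num_leaves T = card {v \<in> verts T. deg T v = 1}"

definition min_leaf_number :: "('a,'b) pre_digraph \<Rightarrow> enat" where
  "min_leaf_number G =
     (if hamiltonian G then 1
      else if \<not> connected G then \<infinity>
      else (INF T \<in> {T. undirected_spanning_tree T G}. enat (num_leaves T)))"

definition two_leaf_stable :: "('a,'b) pre_digraph \<Rightarrow> bool" where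
  "two_leaf_stable G \<longleftrightarrow>
     min_leaf_number G = 2 \<and> (\<forall>v \<in> verts G. min_leaf_number (minus_vertex G v) = 2)"

definition ml_subgraphs :: "('a,'b) pre_digraph \<Rightarrow> ('a,'b) pre_digraph set" where
  "ml_subgraphs G =
     (if hamiltonian G then {S. hamiltonian_cycle S G}
      else {S. undirected_spanning_tree S G \<and> enat (num_leaves S) = min_leaf_number G})"

definition transition_cost ::
  "('a,'b) pre_digraph \<Rightarrow> 'a \<Rightarrow> ('a,'b) pre_digraph \<Rightarrow> ('a,'b) pre_digraph \<Rightarrow> nat" where
  "transition_cost G v S S\<^sub>v = card {u \<in> verts G - {v}. deg S u \<noteq> deg S\<^sub>v u}"

text \<open>
  Minima and maxima are taken in \<^typ>\<open>enat\<close>; they agree with the usual ones whenever the index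
  sets are nonempty, which holds when \<open>G\<close> and all its vertex-deleted subgraphs are connected.
\<close>

definition fault_cost_wrt :: "('a,'b) pre_digraph \<Rightarrow> ('a,'b) pre_digraph \<Rightarrow> enat" where
  "fault_cost_wrt S G =
     (SUP v \<in> verts G. INF S\<^sub>v \<in> ml_subgraphs (minus_vertex G v).
        enat (transition_cost G v S S\<^sub>v))"

definition fault_cost :: "('a,'b) pre_digraph \<Rightarrow> enat" where
  "fault_cost G = (INF S \<in> ml_subgraphs G. fault_cost_wrt S G)"

definition two_connected :: "('a,'b) pre_digraph \<Rightarrow> bool" where
  "two_connected G \<longleftrightarrow>
     3 \<le> card (verts G) \<and> connected G \<and> (\<forall>v \<in> verts G. connected (minus_vertex G v))"

abbreviation minus_vertices :: "('a,'b) pre_digraph \<Rightarrow> 'a set \<Rightarrow> ('a,'b) pre_digraph" where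
  "minus_vertices G X \<equiv> induce_subgraph G (verts G - X)"

definition two_separator :: "('a,'b) pre_digraph \<Rightarrow> 'a set \<Rightarrow> bool" where
  "two_separator G X \<longleftrightarrow>
     X \<subseteq> verts G \<and> card X = 2 \<and> \<not> connected (minus_vertices G X)"

definition two_fragments :: "('a,'b) pre_digraph \<Rightarrow> 'a set \<Rightarrow> ('a,'b) pre_digraph set" where
  "two_fragments G X =
     {induce_subgraph G (verts H \<union> X) | H. H \<in> pre_digraph.sccs (minus_vertices G X)}"

definition P0 :: "('a,'b) pre_digraph \<Rightarrow> 'a \<Rightarrow> 'a \<Rightarrow> 'a \<Rightarrow> bool" where
  "P0 H a x y \<longleftrightarrow>
     (hamiltonian_path H a x \<or> hamiltonian_path H a y) \<and>
     (\<forall>v \<in> verts H - {a}.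
        hamiltonian_path (minus_vertex H v) a x \<or> hamiltonian_path (minus_vertex H v) a y)"

definition Q1 :: "('a,'b) pre_digraph \<Rightarrow> 'a \<Rightarrow> 'a \<Rightarrow> bool" where
  "Q1 H x y \<longleftrightarrow> \<not> hamiltonian_path H x y"

definition Q2 :: "('a,'b) pre_digraph \<Rightarrow> 'a \<Rightarrow> 'a \<Rightarrow> 'a \<Rightarrow> bool" where
  "Q2 H a x y \<longleftrightarrow> (\<forall>v \<in> verts H - {a}. \<not> hamiltonian_path (minus_vertex H v) x y)"

definition weak_fragment :: "('a,'b) pre_digraph \<Rightarrow> 'a \<Rightarrow> 'a \<Rightarrow> 'a \<Rightarrow> bool" where
  "weak_fragment H a x y \<longleftrightarrow>
     graph H \<and> connected H \<and> {a, x, y} \<subseteq> verts H \<and> x \<rightarrow>\<^bsub>H\<^esub> y \<and> P0 H a x y"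

definition medium_fragment :: "('a,'b) pre_digraph \<Rightarrow> 'a \<Rightarrow> 'a \<Rightarrow> 'a \<Rightarrow> bool" where
  "medium_fragment H a x y \<longleftrightarrow> weak_fragment H a x y \<and> Q1 H x y"

definition strong_fragment :: "('a,'b) pre_digraph \<Rightarrow> 'a \<Rightarrow> 'a \<Rightarrow> 'a \<Rightarrow> bool" where
  "strong_fragment H a x y \<longleftrightarrow> weak_fragment H a x y \<and> Q1 H x y \<and> Q2 H a x y"

end

theory Submission
  imports Defs
begin

text \<open>
  A hamiltonian \<open>a\<^sub>1a\<^sub>2\<close>-path of \<open>G\<close> or \<open>G - z\<close> must cross the separator \<open>{x, y}\<close>.  Removing \<open>x\<close>
  and \<open>y\<close> leaves a first segment inside the part of \<open>a\<^sub>1\<close>, a last segment inside the part of \<open>a\<^sub>2\<close>,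
  and a possibly empty middle segment inside one of the parts.  If the middle segment is in the
  part of \<open>a\<^sub>1\<close>, the path restricts to a hamiltonian path of that fragment; otherwise the edge
  \<open>xy\<close> replaces it.  This gives (\<open>P\<^sub>0\<close>).  Conversely, hamiltonian \<open>xy\<close>-paths of the two fragments
  (one possibly with a deleted vertex) glue to a hamiltonian cycle of \<open>G\<close> or \<open>G - v\<close>, which
  2-leaf-stability excludes.  So if (\<open>Q\<^sub>1\<close>) fails for one fragment, the other one is strong.
\<close>

section \<open>Hamiltonian paths and cycles of a relation\<close>

text \<open>The relation is kept apart from the vertex set so that fragments and vertex-deleted
  graphs share the one relation of \<open>G\<close> and differ only in \<open>V\<close>.\<close>

definition ham_path :: "('a \<Rightarrow> 'a \<Rightarrow> bool) \<Rightarrow> 'a set \<Rightarrow> 'a \<Rightarrow> 'a \<Rightarrow> bool" where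
  "ham_path E V a b \<longleftrightarrow>
     (\<exists>p. p \<noteq> [] \<and> distinct p \<and> set p = V \<and> successively E p \<and> hd p = a \<and> last p = b)"

text \<open>Without the bound on the length, an edge run back and forth would count as a
  cycle.\<close>

definition ham_cycle :: "('a \<Rightarrow> 'a \<Rightarrow> bool) \<Rightarrow> 'a set \<Rightarrow> bool" where
  "ham_cycle E V \<longleftrightarrow>
     (\<exists>p. distinct p \<and> 3 \<le> length p \<and> set p = V \<and> successively E (p @ [hd p]))"

lemma ham_pathI:
  assumes "p \<noteq> []" "distinct p" "set p = V" "successively E p" "hd p = a" "last p = b"
  shows "ham_path E V a b"
  using assms unfolding ham_path_def by blast

lemma ham_path_ends:
  assumes "ham_path E V a b"
  shows "a \<in> V" "b \<in> V"
  using assms unfolding ham_path_def by (metis hd_in_set, metis last_in_set)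

lemma successively_rev_sym:
  assumes "symp E"
  shows "successively E (rev p) \<longleftrightarrow> successively E p"
proof -
  have "successively (\<lambda>u v. E v u) p \<longleftrightarrow> successively E p"
    using assms by (intro successively_cong) (auto dest: sympD)
  then show ?thesis
    by simp
qed

lemma ham_path_rev:
  assumes "symp E" "ham_path E V a b"
  shows "ham_path E V b a"
proof -
  obtain p where "p \<noteq> []" "distinct p" "set p = V" "successively E p" "hd p = a" "last p = b"
    using assms(2) unfolding ham_path_def by blast
  then show ?thesis
    by (intro ham_pathI[of "rev p"])
       (auto simp: successively_rev_sym[OF assms(1)] hd_rev last_rev simp del: successively_rev)
qed

lemma ham_cycle_close:
  assumes "ham_path E V a b" "E b a" "3 \<le> card V"
  shows "ham_cycle E V"
proof -
  obtain p where "p \<noteq> []" "distinct p" "set p = V" "successively E p" "hd p = a" "last p = b"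
    using assms(1) unfolding ham_path_def by blast
  with assms(2,3) show ?thesis
    unfolding ham_cycle_def
    by (intro exI[of _ p]) (auto simp: successively_append_iff distinct_card)
qed

text \<open>One path leads from \<open>x\<close> to \<open>y\<close>, and the interior of the other,
  reversed, leads back. \<open>D\<close> may be empty, in which case the edge between
  \<open>x\<close> and \<open>y\<close> closes the cycle; a vertex of \<open>C\<close> provides the
  third vertex.\<close>

lemma ham_cycle_glue:
  assumes "symp E" "C \<inter> D = {}" "x \<notin> C \<union> D" "y \<notin> C \<union> D" "x \<noteq> y" "C \<noteq> {}"
    and C: "ham_path E ({x, y} \<union> C) x y"
    and D: "ham_path E ({x, y} \<union> D) x y"
  shows "ham_cycle E ({x, y} \<union> C \<union> D)"
proof -
  obtain p where p: "p \<noteq> []" "distinct p" "set p = {x, y} \<union> C" "successively E p"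
      "hd p = x" "last p = y"
    using C unfolding ham_path_def by blast
  obtain q where q: "q \<noteq> []" "distinct q" "set q = {x, y} \<union> D" "successively E q"
      "hd q = x" "last q = y"
    using D unfolding ham_path_def by blast
  have "q = [x] \<or> (\<exists>r. q = x # r @ [y])"
    using q(1,5,6) by (cases q; cases "tl q" rule: rev_cases) auto
  then obtain r where r: "q = x # r @ [y]"
    using q(6) \<open>x \<noteq> y\<close> by auto
  have "set r = D"
    using q(2,3) r assms(3,4) by auto
  have r': "successively E (y # rev r @ [x])"
    using q(4) successively_rev_sym[OF assms(1), of q] unfolding r
    by (simp del: successively_rev)
  obtain c where "c \<in> C"
    using \<open>C \<noteq> {}\<close> by blast
  then have "c \<noteq> x" "c \<noteq> y"
    using assms(3,4) by auto
  have "3 \<le> length p"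
  proof -
    have "card {x, y, c} \<le> card (set p)"
      using p(3) \<open>c \<in> C\<close> by (intro card_mono[OF finite_set]) auto
    moreover have "card {x, y, c} = 3"
      using \<open>c \<noteq> x\<close> \<open>c \<noteq> y\<close> \<open>x \<noteq> y\<close> by simp
    ultimately show ?thesis
      using card_length[of p] by linarith
  qed
  moreover have "successively E ((p @ rev r) @ [x])"
  proof -
    obtain p' where "p = p' @ [y]"
      using p(1,6) by (metis append_butlast_last_id)
    then show ?thesis
      using p(4) r' by (simp add: successively_append_iff del: successively_rev)
  qed
  ultimately show ?thesis
    using p q(2) r \<open>set r = D\<close> assms(2-4)
    unfolding ham_cycle_def by (intro exI[of _ "p @ rev r"]) auto
qed

section \<open>Crossing a separator\<close>

text \<open>The separating vertices are not parameters, so the same facts serve for one or two of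
  them and survive the deletion of a vertex from \<open>C\<close>.\<close>

locale separated =
  fixes E :: "'a \<Rightarrow> 'a \<Rightarrow> bool" and C D :: "'a set"
  assumes symp: "symp E"
    and disjoint: "C \<inter> D = {}"
    and no_edge: "u \<in> C \<Longrightarrow> v \<in> D \<Longrightarrow> \<not> E u v"
begin

lemma swap: "separated E D C"
  using symp disjoint no_edge by unfold_locales (auto dest: sympD)

lemma segment_hd:
  assumes "successively E p" "set p \<subseteq> C \<union> D" "p \<noteq> []" "hd p \<in> C"
  shows "set p \<subseteq> C"
  using assms
proof (induction p)
  case (Cons u p)
  then show ?case
    using no_edge by (cases p) auto
qed simp

text \<open>A walk that avoids the separator can never change sides, so its first vertex
  decides.\<close>

lemma segment_cases:
  assumes "successively E p" "set p \<subseteq> C \<union> D"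
  shows "set p \<subseteq> C \<or> set p \<subseteq> D"
proof (cases "p = []")
  case False
  then have "hd p \<in> C \<union> D"
    using assms(2) by (auto dest: hd_in_set)
  then show ?thesis
    using segment_hd[of p] separated.segment_hd[OF swap, of p] assms False by auto
qed simp

lemma segment:
  assumes "successively E p" "set p \<subseteq> C \<union> D" "u \<in> set p"
  shows "u \<in> C \<Longrightarrow> set p \<subseteq> C" "u \<in> D \<Longrightarrow> set p \<subseteq> D"
  using segment_cases[OF assms(1,2)] assms(3) disjoint by auto

text \<open>\<open>z\<close> cuts the path into two segments. The first contains \<open>a\<close>
  and the second \<open>b\<close>, so each stays on its own side, and together they exhaust both
  sides.\<close>

lemma cross_vertex:
  assumes "ham_path E (insert z (C \<union> D)) a b" "z \<notin> C \<union> D" "a \<in> C" "b \<in> D"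
  obtains A B where "set A = C" "set B = D" "distinct A" "distinct B"
    "successively E (A @ z # B)" "A \<noteq> []" "B \<noteq> []" "hd A = a" "last B = b"
proof -
  obtain p where p: "p \<noteq> []" "distinct p" "set p = insert z (C \<union> D)" "successively E p"
      "hd p = a" "last p = b"
    using assms(1) unfolding ham_path_def by blast
  obtain A B where AB: "p = A @ z # B"
    using p(3) split_list[of z p] by auto
  have ne: "A \<noteq> []" "B \<noteq> []"
    using p(5,6) assms(2-4) AB by auto
  then have ends: "hd A = a" "last B = b"
    using p(5,6) AB by auto
  have sub: "set A \<union> set B = C \<union> D"
    using p(2,3) assms(2) AB by auto
  have "set A \<subseteq> C"
  proof -
    have "successively E A"
      using p(4) AB by (auto simp: successively_append_iff)
    moreover have "a \<in> set A"
      using ne ends by auto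
    ultimately show ?thesis
      using segment(1)[of A a] sub assms(3) by auto
  qed
  moreover have "set B \<subseteq> D"
  proof -
    have "successively E B"
      using p(4) AB by (auto simp: successively_append_iff successively_Cons)
    moreover have "b \<in> set B"
      using ne ends by auto
    ultimately show ?thesis
      using segment(2)[of B b] sub assms(4) by auto
  qed
  ultimately have "set A = C" "set B = D"
    using sub disjoint by auto
  then show ?thesis
    using that[of A B] p(2,4) AB ne ends by auto
qed

lemma ham_path_cross_vertex:
  assumes "ham_path E (insert z (C \<union> D)) a b" "z \<notin> C \<union> D" "a \<in> C" "b \<in> D"
  shows "ham_path E (insert z C) a z"
proof -
  obtain A B where "set A = C" "distinct A" "successively E (A @ z # B)" "A \<noteq> []" "hd A = a"
    using cross_vertex[OF assms] by metis
  then show ?thesis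
    using assms(2)
    by (intro ham_pathI[of "A @ [z]"]) (auto simp: successively_append_iff)
qed

text \<open>Here \<open>x\<close> precedes \<open>y\<close> on the path; the restricted path ends in
  whichever separator vertex comes last.\<close>

lemma ham_path_cross_ordered:
  assumes p: "distinct (A @ x # M @ y # B)" "set (A @ x # M @ y # B) = {x, y} \<union> C \<union> D"
      "successively E (A @ x # M @ y # B)"
    and a: "hd (A @ x # M @ y # B) = a" and b: "last (A @ x # M @ y # B) = b"
    and "x \<notin> C \<union> D" "y \<notin> C \<union> D" "a \<in> C" "b \<in> D" "E x y"
  shows "ham_path E ({x, y} \<union> C) a y"
proof -
  have ne: "A \<noteq> []" "B \<noteq> []"
    using a b assms(6-9) by auto
  then have ends: "hd A = a" "last B = b"
    using a b by auto
  have sub: "set A \<union> set M \<union> set B = C \<union> D"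
    using p(1,2) assms(6,7) by auto
  have succ: "successively E A" "successively E M" "successively E B"
      "E (last A) x"
    using p(3) ne by (auto simp: successively_append_iff successively_Cons)
  \<comment> \<open>An empty \<open>M\<close> is included: \<open>x\<close> and \<open>y\<close> are
    then consecutive on the path.\<close>
  have xMy: "successively E (x # M @ [y])"
    using p(3) by (cases "M = []") (auto simp: successively_append_iff successively_Cons)
  have A: "set A \<subseteq> C"
  proof -
    have "a \<in> set A"
      using ne ends by auto
    then show ?thesis
      using segment(1)[of A a] succ sub assms(8) by auto
  qed
  have B: "set B \<subseteq> D"
  proof -
    have "b \<in> set B"
      using ne ends by auto
    then show ?thesis
      using segment(2)[of B b] succ sub assms(9) by auto
  qed
  \<comment> \<open>\<open>A\<close> and \<open>B\<close> each contain an end of the path, which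
    fixes their side; nothing fixes the side of \<open>M\<close>.\<close>
  consider "set M \<subseteq> C" | "set M \<subseteq> D"
    using segment_cases[of M] succ sub by auto
  then show ?thesis
  proof cases
    case 1
    then have "set A \<union> set M = C"
      using A B sub disjoint by auto
    then show ?thesis
      using p(1) succ xMy ne ends
      by (intro ham_pathI[of "A @ x # M @ [y]"])
         (auto simp: successively_append_iff[of _ A])
  next
    case 2
    then have "set A = C"
      using A B sub disjoint by blast
    then show ?thesis
      using p(1) succ ne ends \<open>E x y\<close>
      by (intro ham_pathI[of "A @ [x, y]"]) (auto simp: successively_append_iff[of _ A])
  qed
qed

lemma ham_path_cross:
  assumes "ham_path E ({x, y} \<union> C \<union> D) a b" "x \<notin> C \<union> D" "y \<notin> C \<union> D" "a \<in> C" "b \<in> D"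
    and "x \<noteq> y" "E x y"
  shows "ham_path E ({x, y} \<union> C) a x \<or> ham_path E ({x, y} \<union> C) a y"
proof -
  obtain p where p: "distinct p" "set p = {x, y} \<union> C \<union> D" "successively E p"
      "hd p = a" "last p = b"
    using assms(1) unfolding ham_path_def by blast
  obtain A R where AR: "p = A @ x # R"
    using p(2) split_list[of x p] by auto
  have "y \<in> set A \<union> set R"
    using p(2) AR \<open>x \<noteq> y\<close> by auto
  then consider M B where "R = M @ y # B" | M B where "A = B @ y # M"
    using split_list[of y A] split_list[of y R] by auto
  then show ?thesis
  proof cases
    case 1
    then show ?thesis
      using ham_path_cross_ordered[of A x M y B a b] p AR assms(2-) by simp
  next
    \<comment> \<open>\<open>y\<close> comes first, so the ordered case applies with
      \<open>x\<close> and \<open>y\<close> exchanged and yields a path ending in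
      \<open>x\<close>.\<close>
    case 2
    have "E y x"
      using symp \<open>E x y\<close> by (auto dest: sympD)
    then show ?thesis
      using ham_path_cross_ordered[of B y M x R a b] p AR 2 assms(2-)
      by (simp add: insert_commute)
  qed
qed

text \<open>Behind its start \<open>z\<close> the path is a single segment and cannot visit both
  sides. This serves to keep the ends of the given path out of the separator.\<close>

lemma ham_path_start_outside:
  assumes "ham_path E (insert z (C \<union> D)) z b" "z \<notin> C \<union> D"
  shows "C = {} \<or> D = {}"
proof -
  obtain p where p: "p \<noteq> []" "distinct p" "set p = insert z (C \<union> D)" "successively E p"
      "hd p = z"
    using assms(1) unfolding ham_path_def by blast
  then obtain q where q: "p = z # q"
    by (cases p) auto
  then have "set q = C \<union> D" "successively E q"
    using p(2-4) assms(2) by (auto simp: successively_Cons)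
  then show ?thesis
    using segment_cases[of q] disjoint by auto
qed

end

section \<open>Fragments at a 2-separator crossed by hamiltonian paths\<close>

text \<open>That the two parts exhaust the vertices outside the separator, and that the ends avoid
  \<open>{x, y}\<close>, is derived below. The assumptions are invariant under exchanging
  \<open>x\<close> with \<open>y\<close>, and the parts together with their ends, which halves the
  case distinctions.\<close>

locale crossed_separator =
  fixes E :: "'a \<Rightarrow> 'a \<Rightarrow> bool" and V :: "'a set" and x y :: 'a
    and C\<^sub>1 C\<^sub>2 :: "'a set" and a\<^sub>1 a\<^sub>2 :: 'a
  assumes symp: "symp E"
    and xy: "x \<noteq> y" "x \<in> V" "y \<in> V" "E x y"
    and parts: "C\<^sub>1 \<subseteq> V - {x, y}" "C\<^sub>2 \<subseteq> V - {x, y}" "C\<^sub>1 \<noteq> {}" "C\<^sub>2 \<noteq> {}" "C\<^sub>1 \<inter> C\<^sub>2 = {}"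
    and closed\<^sub>1: "u \<in> C\<^sub>1 \<Longrightarrow> v \<in> V - {x, y} \<Longrightarrow> E u v \<Longrightarrow> v \<in> C\<^sub>1"
    and closed\<^sub>2: "u \<in> C\<^sub>2 \<Longrightarrow> v \<in> V - {x, y} \<Longrightarrow> E u v \<Longrightarrow> v \<in> C\<^sub>2"
    and ends: "a\<^sub>1 \<in> {x, y} \<union> C\<^sub>1" "a\<^sub>2 \<in> {x, y} \<union> C\<^sub>2"
    and path: "ham_path E V a\<^sub>1 a\<^sub>2"
    and path_minus: "z \<in> V - {a\<^sub>1, a\<^sub>2} \<Longrightarrow> ham_path E (V - {z}) a\<^sub>1 a\<^sub>2"
    and no_cycle: "\<not> ham_cycle E V"
    and no_cycle_minus: "z \<in> V \<Longrightarrow> \<not> ham_cycle E (V - {z})"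
begin

lemma swap_xy: "crossed_separator E V y x C\<^sub>1 C\<^sub>2 a\<^sub>1 a\<^sub>2"
  using symp xy parts closed\<^sub>1 closed\<^sub>2 ends path path_minus no_cycle no_cycle_minus
  by unfold_locales (auto dest: sympD)

lemma swap_parts: "crossed_separator E V x y C\<^sub>2 C\<^sub>1 a\<^sub>2 a\<^sub>1"
  using symp xy parts closed\<^sub>1 closed\<^sub>2 ends path path_minus no_cycle no_cycle_minus
  by unfold_locales (auto intro: ham_path_rev)

text \<open>The opposite side is all the rest instead of \<open>C\<^sub>2\<close>, since a third
  component is not yet excluded.\<close>

lemma separated: "separated E C\<^sub>1 (V - {x, y} - C\<^sub>1)"
  using symp closed\<^sub>1 by unfold_locales auto

lemma E_yx: "E y x"
  using symp xy(4) by (rule sympD)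

lemma card_V: "3 \<le> card V"
proof -
  obtain c where c: "c \<in> C\<^sub>1"
    using parts(3) by blast
  then have "c \<noteq> x" "c \<noteq> y" "c \<in> V"
    using parts(1) by auto
  have "finite V"
    using path unfolding ham_path_def by auto
  then have "card {x, y, c} \<le> card V"
    using \<open>c \<in> V\<close> xy by (intro card_mono) auto
  moreover have "card {x, y, c} = 3"
    using \<open>c \<noteq> x\<close> \<open>c \<noteq> y\<close> xy(1) by simp
  ultimately show ?thesis
    by simp
qed

text \<open>A path from \<open>x\<close> to \<open>y\<close> would close up along the edge between
  them. Otherwise \<open>y\<close> is not an end; after its deletion \<open>x\<close> alone
  separates, and a path starting at \<open>x\<close> misses one side.\<close>

lemma start_neq_x: "a\<^sub>1 \<noteq> x"
proof
  assume a1: "a\<^sub>1 = x"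
  show False
  proof (cases "a\<^sub>2 = y")
    case True
    then show False
      using ham_cycle_close[of E V x y] path a1 E_yx card_V no_cycle by auto
  next
    case False
    then have "ham_path E (V - {y}) x a\<^sub>2"
      using path_minus[of y] a1 xy by auto
    moreover have "V - {y} = insert x (C\<^sub>1 \<union> (V - {x, y} - C\<^sub>1))"
      using xy parts by auto
    ultimately show False
      using separated.ham_path_start_outside[OF separated, of x a\<^sub>2] parts by auto
  qed
qed

lemma start_in: "a\<^sub>1 \<in> C\<^sub>1"
  using start_neq_x crossed_separator.start_neq_x[OF swap_xy] ends by auto

lemma end_in: "a\<^sub>2 \<in> C\<^sub>2"
  using crossed_separator.start_in[OF swap_parts] .

lemma end_other: "a\<^sub>2 \<in> V - {x, y} - C\<^sub>1"
  using end_in parts by auto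

lemma fragment_path:
  "ham_path E ({x, y} \<union> C\<^sub>1) a\<^sub>1 x \<or> ham_path E ({x, y} \<union> C\<^sub>1) a\<^sub>1 y"
proof -
  have "V = {x, y} \<union> C\<^sub>1 \<union> (V - {x, y} - C\<^sub>1)"
    using xy parts by auto
  then show ?thesis
    using separated.ham_path_cross[OF separated, of x y a\<^sub>1 a\<^sub>2] path xy parts(1)
      start_in end_other by auto
qed

text \<open>Neither end is \<open>x\<close>, so a path avoiding \<open>x\<close> is given. It can
  change sides only at \<open>y\<close>, and its initial segment followed by \<open>y\<close> is the
  path sought.\<close>

lemma fragment_path_minus_x: "ham_path E ({x, y} \<union> C\<^sub>1 - {x}) a\<^sub>1 y"
proof -
  have "V - {x} = insert y (C\<^sub>1 \<union> (V - {x, y} - C\<^sub>1))"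
    using xy parts by auto
  moreover have "ham_path E (V - {x}) a\<^sub>1 a\<^sub>2"
    using path_minus[of x] xy start_in end_in parts by auto
  ultimately have "ham_path E (insert y C\<^sub>1) a\<^sub>1 y"
    using separated.ham_path_cross_vertex[OF separated, of y a\<^sub>1 a\<^sub>2] parts(1)
      start_in end_other by auto
  moreover have "{x, y} \<union> C\<^sub>1 - {x} = insert y C\<^sub>1"
    using xy parts(1) by auto
  ultimately show ?thesis
    by simp
qed

lemma fragment_path_minus_inner:
  assumes "v \<in> C\<^sub>1 - {a\<^sub>1}"
  shows "ham_path E ({x, y} \<union> C\<^sub>1 - {v}) a\<^sub>1 x \<or> ham_path E ({x, y} \<union> C\<^sub>1 - {v}) a\<^sub>1 y"
proof -
  \<comment> \<open>Deleting \<open>v\<close> keeps the two sides apart, so the crossing argument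
    can be repeated for the path avoiding \<open>v\<close>.\<close>
  interpret S: separated E "C\<^sub>1 - {v}" "V - {x, y} - C\<^sub>1"
    using symp closed\<^sub>1 by unfold_locales auto
  have V: "V - {v} = {x, y} \<union> (C\<^sub>1 - {v}) \<union> (V - {x, y} - C\<^sub>1)"
    using assms xy parts by auto
  have F: "{x, y} \<union> C\<^sub>1 - {v} = {x, y} \<union> (C\<^sub>1 - {v})"
    using assms parts(1) by auto
  have "v \<in> V - {a\<^sub>1, a\<^sub>2}"
    using assms end_in parts by auto
  then have path_v: "ham_path E ({x, y} \<union> (C\<^sub>1 - {v}) \<union> (V - {x, y} - C\<^sub>1)) a\<^sub>1 a\<^sub>2"
    using path_minus[of v] unfolding V by blast
  have "x \<notin> C\<^sub>1 - {v} \<union> (V - {x, y} - C\<^sub>1)" "y \<notin> C\<^sub>1 - {v} \<union> (V - {x, y} - C\<^sub>1)" "a\<^sub>1 \<in> C\<^sub>1 - {v}"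
    using parts(1) start_in assms by auto
  then show ?thesis
    unfolding F by (rule S.ham_path_cross[OF path_v _ _ _ end_other xy(1,4)])
qed

lemma fragment_path_minus:
  assumes "v \<in> {x, y} \<union> C\<^sub>1 - {a\<^sub>1}"
  shows "ham_path E ({x, y} \<union> C\<^sub>1 - {v}) a\<^sub>1 x \<or> ham_path E ({x, y} \<union> C\<^sub>1 - {v}) a\<^sub>1 y"
proof -
  have "ham_path E ({x, y} \<union> C\<^sub>1 - {y}) a\<^sub>1 x"
    using crossed_separator.fragment_path_minus_x[OF swap_xy] by (simp add: insert_commute)
  then show ?thesis
    using fragment_path_minus_x fragment_path_minus_inner[of v] assms by auto
qed

text \<open>With \<open>y\<close> deleted, the path leaves \<open>C\<^sub>1\<close> at
  \<open>x\<close>, and its remainder \<open>B\<close> runs through everything else.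
  \<open>B\<close> ends in \<open>a\<^sub>2\<close> and cannot leave \<open>C\<^sub>2\<close>, so
  there is no room for a third component.\<close>

lemma parts_cover: "V = {x, y} \<union> C\<^sub>1 \<union> C\<^sub>2"
proof -
  have V: "V - {y} = insert x (C\<^sub>1 \<union> (V - {x, y} - C\<^sub>1))"
    using xy parts by auto
  have "y \<in> V - {a\<^sub>1, a\<^sub>2}"
    using xy start_in end_in parts by auto
  then have "ham_path E (insert x (C\<^sub>1 \<union> (V - {x, y} - C\<^sub>1))) a\<^sub>1 a\<^sub>2"
    using path_minus[of y] unfolding V by blast
  moreover have "x \<notin> C\<^sub>1 \<union> (V - {x, y} - C\<^sub>1)"
    using parts by auto
  ultimately obtain A B where B: "set A = C\<^sub>1" "set B = V - {x, y} - C\<^sub>1" "distinct A" "distinct B"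
      "successively E (A @ x # B)" "A \<noteq> []" "B \<noteq> []" "hd A = a\<^sub>1" "last B = a\<^sub>2"
    by (rule separated.cross_vertex[OF separated _ _ start_in end_other])
  interpret S: separated E C\<^sub>2 "V - {x, y} - C\<^sub>2"
    by (rule crossed_separator.separated[OF swap_parts])
  have "successively E B"
    using B(5) by (auto simp: successively_append_iff successively_Cons)
  moreover have "a\<^sub>2 \<in> set B"
    using B(7,9) by auto
  ultimately have "set B \<subseteq> C\<^sub>2"
    using S.segment(1)[of B a\<^sub>2] B(2) end_in by auto
  then show ?thesis
    using B(2) xy parts by auto
qed

text \<open>Were there such a path on the second side too, gluing would give a hamiltonian cycle of
  the whole graph or of the graph without \<open>v\<close>.\<close>

lemma strong_of_xy_path:
  assumes "ham_path E ({x, y} \<union> C\<^sub>1) x y"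
  shows "\<not> ham_path E ({x, y} \<union> C\<^sub>2) x y"
    and "v \<in> {x, y} \<union> C\<^sub>2 \<Longrightarrow> \<not> ham_path E ({x, y} \<union> C\<^sub>2 - {v}) x y"
proof -
  show "\<not> ham_path E ({x, y} \<union> C\<^sub>2) x y"
    using ham_cycle_glue[OF symp _ _ _ _ _ assms, of C\<^sub>2] xy parts no_cycle parts_cover by auto
  show "\<not> ham_path E ({x, y} \<union> C\<^sub>2 - {v}) x y" if v: "v \<in> {x, y} \<union> C\<^sub>2"
  proof
    assume path: "ham_path E ({x, y} \<union> C\<^sub>2 - {v}) x y"
    \<comment> \<open>\<open>x\<close> and \<open>y\<close> are the ends of the path, so neither can
      be the deleted vertex.\<close>
    then have "v \<in> C\<^sub>2"
      using v ham_path_ends by fastforce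
    then have eq: "{x, y} \<union> C\<^sub>2 - {v} = {x, y} \<union> (C\<^sub>2 - {v})"
        "V - {v} = {x, y} \<union> C\<^sub>1 \<union> (C\<^sub>2 - {v})"
      using parts parts_cover by auto
    have "ham_cycle E (V - {v})"
      unfolding eq(2)
      \<comment> \<open>\<open>C\<^sub>2 - {v}\<close> may be empty; \<open>C\<^sub>1\<close> is the
        part that gluing requires to be nonempty.\<close>
      using ham_cycle_glue[OF symp _ _ _ _ _ assms, of "C\<^sub>2 - {v}"] path xy parts
      unfolding eq(1) by auto
    then show False
      using no_cycle_minus \<open>v \<in> C\<^sub>2\<close> parts by auto
  qed
qed

end

section \<open>Transfer to graphs\<close>

lemma set_vwalk_arcs_subset_iff:
  "set (vwalk_arcs p) \<subseteq> R \<longleftrightarrow> successively (\<lambda>u v. (u, v) \<in> R) p"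
  by (induction p rule: vwalk_arcs.induct) auto

text \<open>Agreement on \<open>verts H\<close> suffices because the path stays there;
  \<open>E\<close> can thus be the adjacency of a larger graph.\<close>

lemma hamiltonian_path_iff:
  assumes "\<And>u v. u \<in> verts H \<Longrightarrow> v \<in> verts H \<Longrightarrow> u \<rightarrow>\<^bsub>H\<^esub> v \<longleftrightarrow> E u v"
  shows "hamiltonian_path H a b \<longleftrightarrow> ham_path E (verts H) a b"
proof -
  have "successively (dominates H) p \<longleftrightarrow> successively E p" if "set p = verts H" for p
    using that assms by (intro successively_cong) auto
  then show ?thesis
    unfolding hamiltonian_path_def ham_path_def vpath_def vwalk_def set_vwalk_arcs_subset_iff
    by auto
qed

lemma dominates_induce_iff:
  assumes "u \<in> S" "v \<in> S"
  shows "u \<rightarrow>\<^bsub>G \<restriction> S\<^esub> v \<longleftrightarrow> u \<rightarrow>\<^bsub>G\<^esub> v"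
  using assms by (auto simp: arcs_ends_conv)

text \<open>Vertex deletions are rewritten as induced subgraphs, the form in which paths transfer to
  the relation of \<open>G\<close>.\<close>

lemma minus_vertex_induce: "minus_vertex (G \<restriction> S) v = G \<restriction> (S - {v})"
  by (auto simp: pre_digraph.del_vert_def induce_subgraph_def)

lemma (in wf_digraph) minus_vertex_eq_induce: "minus_vertex G v = G \<restriction> (verts G - {v})"
  by (auto simp: del_vert_def induce_subgraph_def)

lemma hamiltonian_path_induce_iff:
  "hamiltonian_path (G \<restriction> S) a b \<longleftrightarrow> ham_path (dominates G) S a b"
  using hamiltonian_path_iff[of "G \<restriction> S" "dominates G"] dominates_induce_iff[of _ S _ G]
  by simp

lemma (in graph) graph_induce:
  assumes "S \<subseteq> verts G"
  shows "graph (G \<restriction> S)"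
proof -
  have "induced_subgraph (G \<restriction> S) G"
    using assms by (rule induced_induce)
  then interpret D: digraph "G \<restriction> S"
    by (rule digraphI_induced)
  show ?thesis
    using \<open>induced_subgraph _ _\<close> induced_graph_imp_symmetric[OF sym_arcs] by blast
qed

lemma (in graph) graph_symp: "symp (dominates G)"
  using graph_symmetric by (auto intro: sympI)

lemma (in graph) hamiltonian_if_ham_cycle:
  assumes "ham_cycle (dominates G) (verts G)"
  shows "hamiltonian G"
proof -
  obtain p where p: "distinct p" "3 \<le> length p" "set p = verts G"
      "successively (dominates G) (p @ [hd p])"
    using assms unfolding ham_cycle_def by blast
  \<comment> \<open>The converse is added because an undirected edge is a pair of opposite
    arcs.\<close>
  define S where "S = set (vwalk_arcs (p @ [hd p])) \<union> (set (vwalk_arcs (p @ [hd p])))\<inverse>"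
  define K where "K = \<lparr>verts = verts G, arcs = {e \<in> arcs G. arc_to_ends G e \<in> S},
    tail = tail G, head = head G\<rparr>"
  \<comment> \<open>Every pair in \<open>S\<close> is realised by an arc of \<open>G\<close>, so
    filtering the arcs loses no edge of the cycle.\<close>
  have "S \<subseteq> arcs_ends G"
    using p(4) graph_symmetric set_vwalk_arcs_subset_iff[of "p @ [hd p]" "arcs_ends G"]
    unfolding S_def by auto
  then have ends: "arcs_ends K = S"
    unfolding K_def arcs_ends_def by (auto simp: arc_to_ends_def image_iff)
  have "wf_digraph K"
    unfolding K_def by unfold_locales auto
  then have sub: "subgraph K G"
    unfolding K_def by (auto simp: subgraph_def compatible_def wf_digraph)
  have "sym S"
    unfolding S_def by (auto simp: sym_def)
  then have "graph K"
    using \<open>wf_digraph K\<close> ends no_multi_arcs no_loops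
    unfolding K_def
    by unfold_locales (auto simp: symmetric_def arc_to_ends_def)
  then have "undirected_cycle K"
    unfolding undirected_cycle_def ends using p by (intro conjI exI[of _ p]) (auto simp: K_def S_def)
  with sub show ?thesis
    unfolding hamiltonian_def hamiltonian_cycle_def spanning_def by (auto simp: K_def)
qed

text \<open>The path reaches every vertex from its first one, and symmetry makes reachability
  mutual. This supplies the connectedness of the fragments.\<close>

lemma (in graph) connected_if_ham_path:
  assumes "ham_path (dominates G) (verts G) a b"
  shows "connected G"
proof -
  obtain p where p: "p \<noteq> []" "set p = verts G" "successively (dominates G) p"
    using assms unfolding ham_path_def by blast
  have "hd q \<rightarrow>\<^sup>* u" if "successively (dominates G) q" "set q \<subseteq> verts G" "u \<in> set q" for q u
    using that
  proof (induction q)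
    case (Cons w q)
    then show ?case
      by (cases q) (auto intro: adj_reachable_trans)
  qed simp
  then have "hd p \<rightarrow>\<^sup>* u" if "u \<in> verts G" for u
    using p that by auto
  then have "u \<rightarrow>\<^sup>* v" if "u \<in> verts G" "v \<in> verts G" for u v
    using that reachable_trans symmetric_reachable[OF sym_arcs] by blast
  then show ?thesis
    using p by (intro connectedI) (auto simp: reachable_mk_symmetric_eq[OF sym_arcs])
qed

lemma not_hamiltonian_if_min_leaf_number: "min_leaf_number G \<noteq> 1 \<Longrightarrow> \<not> hamiltonian G"
  by (auto simp: min_leaf_number_def)

section \<open>Fragments of the graph and the final case distinction\<close>

text \<open>The ends of an edge avoiding \<open>X\<close> reach each other through its two opposite
  arcs, hence share a component; this gives the closure property of
  \<open>crossed_separator\<close>.\<close>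

lemma two_fragmentE:
  assumes "graph G" "F \<in> two_fragments G X"
  obtains C where "F = G \<restriction> (X \<union> C)"
    "C \<in> pre_digraph.sccs_verts (minus_vertices G X)"
    "C \<subseteq> verts G - X" "C \<noteq> {}"
    "\<forall>u\<in>C. \<forall>v\<in>verts G - X. u \<rightarrow>\<^bsub>G\<^esub> v \<longrightarrow> v \<in> C"
proof -
  interpret G: graph G by fact
  interpret M: graph "minus_vertices G X"
    by (rule G.graph_induce) auto
  obtain H where H: "F = G \<restriction> (verts H \<union> X)" "H \<in> M.sccs"
    using assms(2) unfolding two_fragments_def by auto
  have scc: "verts H \<in> M.sccs_verts"
    using H(2) by (intro M.in_sccs_vertsI_sccs) auto
  have sub: "verts H \<subseteq> verts G - X"
    using M.in_sccs_imp_induced[OF H(2)] by (auto simp: induced_subgraph_def subgraph_def)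
  have closed: "v \<in> verts H" if "u \<in> verts H" "v \<in> verts G - X" "u \<rightarrow>\<^bsub>G\<^esub> v" for u v
  proof -
    have "u \<rightarrow>\<^bsub>minus_vertices G X\<^esub> v"
      using that sub dominates_induce_iff[of u "verts G - X" v G] by auto
    then have "u \<rightarrow>\<^sup>*\<^bsub>minus_vertices G X\<^esub> v" "v \<rightarrow>\<^sup>*\<^bsub>minus_vertices G X\<^esub> u"
      using M.graph_symmetric by auto
    then show ?thesis
      using scc that(1) unfolding M.in_sccs_verts_conv_reachable by blast
  qed
  show ?thesis
  proof (rule that[OF _ scc sub])
    show "F = G \<restriction> (X \<union> verts H)"
      using H(1) by (simp add: Un_commute)
    show "verts H \<noteq> {}"
      using scc unfolding M.in_sccs_verts_conv_reachable by blast
    show "\<forall>u\<in>verts H. \<forall>v\<in>verts G - X. u \<rightarrow>\<^bsub>G\<^esub> v \<longrightarrow> v \<in> verts H"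
      using closed by blast
  qed
qed

lemma (in graph) weak_fragmentI:
  assumes "crossed_separator (dominates G) (verts G) x y C\<^sub>1 C\<^sub>2 a\<^sub>1 a\<^sub>2"
  shows "weak_fragment (G \<restriction> ({x, y} \<union> C\<^sub>1)) a\<^sub>1 x y"
proof -
  interpret S: crossed_separator "dominates G" "verts G" x y C\<^sub>1 C\<^sub>2 a\<^sub>1 a\<^sub>2
    by fact
  let ?H = "G \<restriction> ({x, y} \<union> C\<^sub>1)"
  have H: "graph ?H"
    using S.xy S.parts by (intro graph_induce) auto
  have "connected ?H"
  proof -
    \<comment> \<open>The connectivity criterion refers to the relation of the fragment itself, so
      the path is transferred back from that of \<open>G\<close>.\<close>
    have "ham_path (dominates ?H) (verts ?H) a\<^sub>1 x \<or> ham_path (dominates ?H) (verts ?H) a\<^sub>1 y"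
      using S.fragment_path hamiltonian_path_iff[of ?H "dominates ?H"]
      by (auto simp: hamiltonian_path_induce_iff)
    then show ?thesis
      using graph.connected_if_ham_path[OF H] by blast
  qed
  moreover have "x \<rightarrow>\<^bsub>?H\<^esub> y"
    using S.xy dominates_induce_iff[of x "{x, y} \<union> C\<^sub>1" y G] by simp
  moreover have "P0 ?H a\<^sub>1 x y"
    using S.fragment_path S.fragment_path_minus
    unfolding P0_def minus_vertex_induce hamiltonian_path_induce_iff by simp
  ultimately show ?thesis
    using H S.start_in unfolding weak_fragment_def by simp
qed

text \<open>Failure of \<open>Q1\<close> supplies the \<open>xy\<close>-path with which no
  \<open>xy\<close>-path of the other fragment may be glued.\<close>

lemma (in graph) strong_fragmentI:
  assumes "crossed_separator (dominates G) (verts G) x y C\<^sub>1 C\<^sub>2 a\<^sub>1 a\<^sub>2"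
    and "\<not> Q1 (G \<restriction> ({x, y} \<union> C\<^sub>1)) x y"
  shows "strong_fragment (G \<restriction> ({x, y} \<union> C\<^sub>2)) a\<^sub>2 x y"
proof -
  interpret S: crossed_separator "dominates G" "verts G" x y C\<^sub>1 C\<^sub>2 a\<^sub>1 a\<^sub>2
    by fact
  have "ham_path (dominates G) ({x, y} \<union> C\<^sub>1) x y"
    using assms(2) unfolding Q1_def hamiltonian_path_induce_iff by simp
  then show ?thesis
    using S.strong_of_xy_path weak_fragmentI[OF S.swap_parts]
    unfolding strong_fragment_def Q1_def Q2_def minus_vertex_induce hamiltonian_path_induce_iff
    by simp
qed

theorem theorem10:
  fixes G G\<^sub>1 G\<^sub>2 :: "('a,'b) pre_digraph"
    and a\<^sub>1 a\<^sub>2 x y :: 'a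
  assumes "graph G"
    and "two_connected G"
    and "two_leaf_stable G"
    and "fault_cost G = 1"
    and "a\<^sub>1 \<in> verts G" and "a\<^sub>2 \<in> verts G"
    and "hamiltonian_path G a\<^sub>1 a\<^sub>2"
    and "\<And>z. z \<in> verts G - {a\<^sub>1, a\<^sub>2} \<Longrightarrow> hamiltonian_path (minus_vertex G z) a\<^sub>1 a\<^sub>2"
    and "two_separator G {x, y}"
    and "x \<rightarrow>\<^bsub>G\<^esub> y"
    and "G\<^sub>1 \<in> two_fragments G {x, y}" and "G\<^sub>2 \<in> two_fragments G {x, y}"
    and "G\<^sub>1 \<noteq> G\<^sub>2"
    and "a\<^sub>1 \<in> verts G\<^sub>1" and "a\<^sub>2 \<in> verts G\<^sub>2"
  shows "weak_fragment G\<^sub>1 a\<^sub>1 x y \<and> weak_fragment G\<^sub>2 a\<^sub>2 x y \<and>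
    ((medium_fragment G\<^sub>1 a\<^sub>1 x y \<and> medium_fragment G\<^sub>2 a\<^sub>2 x y) \<or>
     strong_fragment G\<^sub>1 a\<^sub>1 x y \<or> strong_fragment G\<^sub>2 a\<^sub>2 x y)"
proof -
  interpret graph G by fact
  interpret M: graph "minus_vertices G {x, y}"
    by (rule graph_induce) auto
  obtain C\<^sub>1 where C1: "G\<^sub>1 = G \<restriction> ({x, y} \<union> C\<^sub>1)" "C\<^sub>1 \<in> M.sccs_verts"
    "C\<^sub>1 \<subseteq> verts G - {x, y}" "C\<^sub>1 \<noteq> {}"
    "\<forall>u\<in>C\<^sub>1. \<forall>v\<in>verts G - {x, y}. u \<rightarrow>\<^bsub>G\<^esub> v \<longrightarrow> v \<in> C\<^sub>1"
    by (rule two_fragmentE[OF assms(1,11)])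
  obtain C\<^sub>2 where C2: "G\<^sub>2 = G \<restriction> ({x, y} \<union> C\<^sub>2)" "C\<^sub>2 \<in> M.sccs_verts"
    "C\<^sub>2 \<subseteq> verts G - {x, y}" "C\<^sub>2 \<noteq> {}"
    "\<forall>u\<in>C\<^sub>2. \<forall>v\<in>verts G - {x, y}. u \<rightarrow>\<^bsub>G\<^esub> v \<longrightarrow> v \<in> C\<^sub>2"
    by (rule two_fragmentE[OF assms(1,12)])
  \<comment> \<open>Distinct fragments come from distinct components, and these are
    disjoint.\<close>
  have disj: "C\<^sub>1 \<inter> C\<^sub>2 = {}"
    using M.sccs_verts_disjoint[OF C1(2) C2(2)] C1(1) C2(1) assms(13) by auto
  have path: "ham_path (dominates G) (verts G) a\<^sub>1 a\<^sub>2"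
    using assms(7) hamiltonian_path_iff[of G "dominates G"] by simp
  have path_minus: "ham_path (dominates G) (verts G - {z}) a\<^sub>1 a\<^sub>2"
    if "z \<in> verts G - {a\<^sub>1, a\<^sub>2}" for z
    using assms(8)[OF that] unfolding minus_vertex_eq_induce hamiltonian_path_induce_iff .
  have no_cycle: "\<not> ham_cycle (dominates G) (verts G)"
    using assms(3) not_hamiltonian_if_min_leaf_number[of G] hamiltonian_if_ham_cycle
    unfolding two_leaf_stable_def by auto
  have no_cycle_minus: "\<not> ham_cycle (dominates G) (verts G - {z})" if "z \<in> verts G" for z
  proof
    let ?H = "G \<restriction> (verts G - {z})"
    assume "ham_cycle (dominates G) (verts G - {z})"
    then obtain p where p: "distinct p" "3 \<le> length p" "set p = verts G - {z}"
        "successively (dominates G) (p @ [hd p])"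
      unfolding ham_cycle_def by blast
    \<comment> \<open>The closing arc returns to \<open>hd p\<close>, so this vertex too must lie in
      the induced subgraph.\<close>
    have "hd p \<in> set p"
      using p(2) by (intro hd_in_set) auto
    then have "successively (dominates ?H) (p @ [hd p])"
      using p(3,4) dominates_induce_iff[of _ "verts G - {z}" _ G]
      by (subst successively_cong[OF _ refl, of _ _ "dominates G"]) auto
    then have "ham_cycle (dominates ?H) (verts ?H)"
      using p unfolding ham_cycle_def by auto
    then have "hamiltonian ?H"
      by (intro graph.hamiltonian_if_ham_cycle graph_induce) auto
    then show False
      using assms(3) that not_hamiltonian_if_min_leaf_number[of ?H]
      unfolding two_leaf_stable_def minus_vertex_eq_induce by auto
  qed
  have S: "crossed_separator (dominates G) (verts G) x y C\<^sub>1 C\<^sub>2 a\<^sub>1 a\<^sub>2"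
  proof
    show "x \<noteq> y" "x \<in> verts G" "y \<in> verts G"
      using assms(9) unfolding two_separator_def by auto
  qed (use assms(10,14,15) C1 C2 disj path path_minus no_cycle no_cycle_minus graph_symp in auto)
  then have S': "crossed_separator (dominates G) (verts G) x y C\<^sub>2 C\<^sub>1 a\<^sub>2 a\<^sub>1"
    by (rule crossed_separator.swap_parts)
  \<comment> \<open>The disjunction is split on \<open>Q1\<close>: if it holds on both sides, both
    are medium; if it fails on one, the other is strong.\<close>
  show ?thesis
    using weak_fragmentI[OF S] weak_fragmentI[OF S'] strong_fragmentI[OF S] strong_fragmentI[OF S']
    unfolding C1(1) C2(1) medium_fragment_def by blast
qed

end
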